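(* For $n\ge 0$ let $a(n)$ be the number of permutations $\pi$ of $\{1,\dots,n\}$ such that $|\pi_{i+1}-\pi_i|\neq 1$ for all $1\le i\le n-1$ (with $a(0)=1$). Then for all $n\ge 4$, $$a(n)=(n+1)\,a(n-1)-(n-2)\,a(n-2)-(n-5)\,a(n-3)+(n-3)\,a(n-4).$$
   Context: A permutation $\pi$ of $\{1,\dots,n\}$ is written $\pi_1\pi_2\cdots\pi_n$. The empty permutation is the unique permutation of length $0$. *)

theory Defs
  imports "HOL-Combinatorics.Permutations"
begin

text \<open>The differences are taken in the integers, since subtraction on the natural
  numbers truncates. For \<open>n = 0\<close> the only permutation of the empty set is the
  identity, see \<open>num_nonconsecutive_perms_0\<close>.\<close>

definition nonconsecutive_perms :: "nat \<Rightarrow> (nat \<Rightarrow> nat) set" where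
  "nonconsecutive_perms n =
     {p. p permutes {1..n} \<and> (\<forall>i\<in>{1..<n}. \<bar>int (p (i + 1)) - int (p i)\<bar> \<noteq> 1)}"

definition num_nonconsecutive_perms :: "nat \<Rightarrow> nat" where
  "num_nonconsecutive_perms n = card (nonconsecutive_perms n)"

lemma finite_nonconsecutive_perms: "finite (nonconsecutive_perms n)"
  unfolding nonconsecutive_perms_def
  by (rule finite_subset[OF _ finite_permutations[of "{1..n}"]]) auto

lemma num_nonconsecutive_perms_0: "num_nonconsecutive_perms 0 = 1"
  by (simp add: num_nonconsecutive_perms_def nonconsecutive_perms_def)

end

theory Submission
  imports Defs "HOL-Combinatorics.Multiset_Permutations" "HOL-Computational_Algebra.Polynomial"
begin

text \<open>
  Call two neighbouring entries of a permutation a bond if they differ by one, and let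
  \<open>T\<^sub>n(t)\<close> be the sum of \<open>t ^ bonds \<pi>\<close> over the permutations \<open>\<pi>\<close> of \<open>{1..n}\<close>
  (\<open>bond_poly\<close>). The number wanted is \<open>a(n) = T\<^sub>n(0)\<close>. Write \<open>u = 1 - t\<close>, and let
  primes be derivatives in \<open>t\<close>.

  Every permutation of \<open>{1..n+1}\<close> arises once by inserting \<open>n + 1\<close> into one of the \<open>n + 1\<close>
  gaps of a permutation of \<open>{1..n}\<close>. This destroys a bond if the gap lies inside a bond,
  and creates one if the gap is next to the entry \<open>n\<close>. Both happen at once exactly when the gap
  lies inside a bond that contains \<open>n\<close>, so the insertion step closes up once the
  permutations in which \<open>n\<close> belongs to a bond are recorded separately, by a
  second polynomial (\<open>top_bond_poly\<close>). Eliminating it from \<open>bond_poly_Suc\<close> and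
  \<open>top_bond_poly_Suc\<close> leaves (\<open>bond_poly_rec\<close>)
  \<open>T\<^sub>n\<^sub>+\<^sub>2 = u T'\<^sub>n\<^sub>+\<^sub>1 + (n + 2 - u) T\<^sub>n\<^sub>+\<^sub>1 - u\<^sup>2 T'\<^sub>n - (n + 1) u T\<^sub>n\<close>.

  At \<open>t = 0\<close> this involves the derivatives \<open>b(n) = T'\<^sub>n(0)\<close>, which count the permutations with
  exactly one bond; differentiating further would bring in ever more unknowns. A second relation
  ends the regress (\<open>pderiv_bond_poly_rec\<close>):
  \<open>T'\<^sub>n\<^sub>+\<^sub>2 = 2 u T'\<^sub>n\<^sub>+\<^sub>1 + u\<^sup>2 T'\<^sub>n + 2 (n + 1) T\<^sub>n\<^sub>+\<^sub>1\<close>.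
  It comes from the generating function: marking a set of bonds and contracting the runs that they
  form gives \<open>\<Sum>\<^sub>n T\<^sub>n x^n = \<Sum>\<^sub>m m! y^m\<close> with \<open>y = x (1 - u x) / (1 + u x)\<close>. As a function of
  \<open>y\<close> alone, this series is annihilated by every first-order differential operator in \<open>x\<close> and \<open>u\<close>
  that annihilates \<open>y\<close>, such as
  \<open>(1 - 2z - z\<^sup>2) u \<partial>\<^sub>u + 2z x \<partial>\<^sub>x\<close> with \<open>z = u x\<close>; the second relation is the comparison of
  coefficients. The formal proof verifies it by induction from the first relation.

  Setting \<open>t = 0\<close> in both relations and eliminating \<open>b\<close> yields the recurrence for \<open>a\<close>.
\<close>

section \<open>Counting adjacent pairs in a list\<close>

fun count_adj :: "('a \<Rightarrow> 'a \<Rightarrow> bool) \<Rightarrow> 'a list \<Rightarrow> nat" where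
  "count_adj P (x # y # xs) = of_bool (P x y) + count_adj P (y # xs)"
| "count_adj P _ = 0"

text \<open>Gap \<open>i\<close> of a list of length \<open>n\<close>, for \<open>0 \<le> i \<le> n\<close>, is the place before entry \<open>i\<close>. The outer gaps \<open>0\<close>
  and \<open>n\<close> lie between no two entries.\<close>
definition gap_between :: "('a \<Rightarrow> 'a \<Rightarrow> bool) \<Rightarrow> 'a list \<Rightarrow> nat \<Rightarrow> bool" where
  "gap_between P xs i \<longleftrightarrow> 0 < i \<and> i < length xs \<and> P (xs ! (i - 1)) (xs ! i)"

lemma count_adj_append:
  "count_adj P (xs @ ys) = count_adj P xs + count_adj P ys + of_bool (gap_between P (xs @ ys) (length xs))"
proof (induction xs rule: induct_list012)
  case (2 x)
  then show ?case by (cases ys) (auto simp: gap_between_def)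
qed (auto simp: gap_between_def)

lemma sum_gap_between: "(\<Sum>i\<le>length xs. of_bool (gap_between P xs i)) = count_adj P xs"
proof (induction xs)
  case (Cons x xs)
  have "(\<Sum>i\<le>length (x # xs). of_bool (gap_between P (x # xs) i))
      = (\<Sum>i\<le>length xs. of_bool (gap_between P (x # xs) (Suc i)) :: nat)"
    unfolding length_Cons sum.atMost_Suc_shift by (simp add: gap_between_def)
  also have "\<dots> = (\<Sum>i\<le>length xs. of_bool (gap_between P xs i) + of_bool (i = 0 \<and> xs \<noteq> [] \<and> P x (hd xs)))"
  proof (intro sum.cong refl)
    fix i assume "i \<in> {..length xs}"
    show "of_bool (gap_between P (x # xs) (Suc i))
        = (of_bool (gap_between P xs i) + of_bool (i = 0 \<and> xs \<noteq> [] \<and> P x (hd xs)) :: nat)"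
      by (cases i; cases "xs = []") (auto simp: gap_between_def hd_conv_nth)
  qed
  also have "\<dots> = count_adj P xs + (\<Sum>i\<le>length xs. if i = 0 then of_bool (xs \<noteq> [] \<and> P x (hd xs)) else 0)"
    unfolding sum.distrib Cons.IH by (intro arg_cong2[of _ _ _ _ "(+)"] sum.cong) auto
  also have "\<dots> = count_adj P (x # xs)"
    by (cases xs) auto
  finally show ?case .
qed (auto simp: gap_between_def)

section \<open>Inserting a new maximum\<close>

definition bond :: "nat \<Rightarrow> nat \<Rightarrow> bool" where
  "bond x y \<longleftrightarrow> \<bar>int y - int x\<bar> = 1"

definition bond_at :: "nat \<Rightarrow> nat \<Rightarrow> nat \<Rightarrow> bool" where
  "bond_at m x y \<longleftrightarrow> bond x y \<and> (x = m \<or> y = m)"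

definition insert_at :: "nat \<Rightarrow> 'a \<Rightarrow> 'a list \<Rightarrow> 'a list" where
  "insert_at i x xs = take i xs @ x # drop i xs"

definition beside :: "'a \<Rightarrow> 'a list \<Rightarrow> nat \<Rightarrow> bool" where
  "beside x xs i \<longleftrightarrow> (0 < i \<and> xs ! (i - 1) = x) \<or> (i < length xs \<and> xs ! i = x)"

text \<open>The gaps next to an entry are the one before it and the one after it, even for an entry at an end
  of the list, because the outer gaps count. This is why the two recurrences below have
  uniform coefficients.\<close>

lemma sum_beside:
  assumes "distinct xs" "x \<in> set xs"
  shows "(\<Sum>i\<le>length xs. of_bool (beside x xs i)) = (2 :: nat)"
proof -
  obtain p where p: "p < length xs" "xs ! p = x"
    using assms(2) by (auto simp: in_set_conv_nth)
  have "{i. i \<le> length xs \<and> beside x xs i} = {p, Suc p}"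
    using p assms(1) by (auto simp: beside_def nth_eq_iff_index_eq)
  moreover have "(\<Sum>i\<le>length xs. of_bool (beside x xs i)) = card {i. i \<le> length xs \<and> beside x xs i}"
    by (simp add: Collect_conj_eq atMost_def)
  ultimately show ?thesis by simp
qed

text \<open>The pair across gap \<open>i\<close> is lost and two new pairs appear. The lost pair is written on the left-hand
  side, which avoids truncated subtraction.\<close>

lemma count_adj_insert_at:
  assumes i: "i \<le> length xs"
  shows "count_adj P (insert_at i x xs) + of_bool (gap_between P xs i)
    = count_adj P xs + of_bool (0 < i \<and> P (xs ! (i - 1)) x) + of_bool (i < length xs \<and> P x (xs ! i))"
proof -
  have 1: "count_adj P xs = count_adj P (take i xs) + count_adj P (drop i xs) + of_bool (gap_between P xs i)"
    using count_adj_append[of P "take i xs" "drop i xs"] i by (simp add: min_def)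
  have 2: "count_adj P (x # drop i xs) = count_adj P (drop i xs) + of_bool (i < length xs \<and> P x (xs ! i))"
    using i by (cases "drop i xs") (auto simp: nth_via_drop dest: nth_via_drop)
  have 3: "count_adj P (insert_at i x xs) = count_adj P (take i xs) + count_adj P (x # drop i xs)
     + of_bool (0 < i \<and> P (xs ! (i - 1)) x)"
    using i unfolding insert_at_def count_adj_append
    by (auto simp: gap_between_def nth_append min_def)
  show ?thesis using 1 2 3 by linarith
qed

text \<open>Below \<open>n + 1\<close>, only \<open>n\<close> forms a bond with it. By distinctness \<open>n\<close> is on one side of the gap
  at most, so at most one new bond appears, and it is the only bond that contains \<open>n + 1\<close>.\<close>

lemma bonds_insert_top:
  assumes xs: "xs \<in> permutations_of_set {1..n}" and i: "i \<le> n"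
  shows "count_adj bond (insert_at i (Suc n) xs) + of_bool (gap_between bond xs i)
      = count_adj bond xs + of_bool (beside n xs i)"
    and "count_adj (bond_at (Suc n)) (insert_at i (Suc n) xs) = of_bool (beside n xs i)"
proof -
  have D: "distinct xs" "set xs = {1..n}" using xs by (auto dest: permutations_of_setD)
  have len: "length xs = n" using D distinct_card by fastforce
  have bd: "xs ! j \<le> n" "1 \<le> xs ! j" if "j < n" for j using that len D(2) nth_mem[of j xs] by auto
  have b: "bond (xs ! j) (Suc n) \<longleftrightarrow> xs ! j = n" "bond (Suc n) (xs ! j) \<longleftrightarrow> xs ! j = n" if "j < n" for j
    using bd[OF that] by (auto simp: bond_def)
  have excl: "\<not> (0 < i \<and> xs ! (i - 1) = n \<and> i < n \<and> xs ! i = n)"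
    using D(1) len nth_eq_iff_index_eq[of xs "i - 1" i] by fastforce
  have sum: "of_bool (0 < i \<and> xs ! (i - 1) = n) + of_bool (i < n \<and> xs ! i = n) = (of_bool (beside n xs i) :: nat)"
    using excl by (auto simp: beside_def len)
  have L: "(0 < i \<and> bond (xs ! (i - 1)) (Suc n)) = (0 < i \<and> xs ! (i - 1) = n)"
    and R: "(i < length xs \<and> bond (Suc n) (xs ! i)) = (i < n \<and> xs ! i = n)"
    using b[of "i - 1"] b[of i] i len by auto
  show "count_adj bond (insert_at i (Suc n) xs) + of_bool (gap_between bond xs i)
      = count_adj bond xs + of_bool (beside n xs i)"
    using count_adj_insert_at[of i xs bond "Suc n", unfolded L R] i sum len by linarith
  have no: "\<not> gap_between (bond_at (Suc n)) xs j" for j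
  proof
    assume "gap_between (bond_at (Suc n)) xs j"
    then have j: "j < n" "j - 1 < n" and "xs ! (j - 1) = Suc n \<or> xs ! j = Suc n"
      using len by (auto simp: gap_between_def bond_at_def)
    then show False using bd(1)[OF j(1)] bd(1)[OF j(2)] by linarith
  qed
  then have "count_adj (bond_at (Suc n)) xs = 0" unfolding sum_gap_between[symmetric] by simp
  then show "count_adj (bond_at (Suc n)) (insert_at i (Suc n) xs) = of_bool (beside n xs i)"
    using count_adj_insert_at[of i xs "bond_at (Suc n)" "Suc n"] i sum no L R len
    by (simp add: bond_at_def)
qed

text \<open>The insertion is injective because \<open>n + 1\<close> is new, so its position marks the gap, and deleting it
  restores the list. Surjectivity follows by counting: both sides have \<open>(n + 1)!\<close> elements.\<close>

lemma sum_permutations_Suc: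
  "(\<Sum>ys\<in>permutations_of_set {1..Suc n}. f ys)
    = (\<Sum>xs\<in>permutations_of_set {1..n}. \<Sum>i\<le>n. f (insert_at i (Suc n) xs))"
proof -
  have "bij_betw (\<lambda>(xs, i). insert_at i (Suc n) xs) (permutations_of_set {1..n} \<times> {..n}) (permutations_of_set {1..Suc n})"
    unfolding bij_betw_def
  proof
    show inj: "inj_on (\<lambda>(xs, i). insert_at i (Suc n) xs) (permutations_of_set {1..n} \<times> {..n})"
    proof (rule inj_onI, clarsimp)
      fix xs i ys j
      assume xs: "xs \<in> permutations_of_set {Suc 0..n}" and i: "i \<le> n"
        and ys: "ys \<in> permutations_of_set {Suc 0..n}" and j: "j \<le> n"
        and eq: "insert_at i (Suc n) xs = insert_at j (Suc n) ys"
      have len: "length xs = n" "length ys = n"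
        using xs ys length_finite_permutations_of_set by force+
      have notin: "Suc n \<notin> set xs" "Suc n \<notin> set ys"
        using xs ys by (auto dest: permutations_of_setD)
      have "take i xs = take j ys \<and> drop i xs = drop j ys"
        using eq notin unfolding insert_at_def
        by (subst (asm) append_Cons_eq_iff) (auto dest: in_set_takeD in_set_dropD)
      then show "xs = ys \<and> i = j"
        using len i j by (metis append_take_drop_id length_take min.absorb2)
    qed
    show "(\<lambda>(xs, i). insert_at i (Suc n) xs) ` (permutations_of_set {1..n} \<times> {..n}) = permutations_of_set {1..Suc n}"
    proof (rule card_subset_eq)
      show "(\<lambda>(xs, i). insert_at i (Suc n) xs) ` (permutations_of_set {1..n} \<times> {..n}) \<subseteq> permutations_of_set {1..Suc n}"
      proof clarify
        fix xs i assume xs: "xs \<in> permutations_of_set {1..n}"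
        have split: "set xs = set (take i xs) \<union> set (drop i xs)"
          by (metis append_take_drop_id set_append)
        have "set (insert_at i (Suc n) xs) = {1..Suc n}"
          using permutations_of_setD(1)[OF xs] split by (auto simp: insert_at_def)
        moreover have "distinct (insert_at i (Suc n) xs)"
          using permutations_of_setD[OF xs] set_take_disj_set_drop_if_distinct[of xs i i]
          by (auto simp: insert_at_def dest: in_set_takeD in_set_dropD)
        ultimately show "insert_at i (Suc n) xs \<in> permutations_of_set {1..Suc n}" by blast
      qed
      show "card ((\<lambda>(xs, i). insert_at i (Suc n) xs) ` (permutations_of_set {1..n} \<times> {..n})) = card (permutations_of_set {1..Suc n})"
        unfolding card_image[OF inj] by (simp add: card_cartesian_product)
    qed simp
  qed
  from sum.reindex_bij_betw[OF this, of f] show ?thesis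
    by (simp add: sum.cartesian_product split_def)
qed

section \<open>Bond polynomials\<close>

definition tvar :: "int poly" where "tvar = [:0, 1:]"

definition uvar :: "int poly" where "uvar = 1 - tvar"

lemma pderiv_tvar: "pderiv tvar = 1"
  by (simp add: tvar_def pderiv_pCons one_pCons)

lemma pderiv_uvar: "pderiv uvar = -1"
  by (simp add: uvar_def pderiv_diff pderiv_tvar)

lemma pderiv_tvar_power: "pderiv (tvar ^ k) = of_nat k * tvar ^ (k - 1)"
  by (simp add: pderiv_power pderiv_tvar of_nat_poly)

definition bond_poly :: "nat \<Rightarrow> int poly" where
  "bond_poly n = (\<Sum>xs\<in>permutations_of_set {1..n}. tvar ^ count_adj bond xs)"

text \<open>The entry \<open>n\<close> can only be bonded to \<open>n - 1\<close>, so the factor \<open>count_adj (bond_at n) xs\<close> is \<open>0\<close> or \<open>1\<close>: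
  this is the generating polynomial of the permutations in which \<open>n\<close> is bonded, with that
  bond left uncounted. The exponent never truncates where the factor is nonzero.\<close>
definition top_bond_poly :: "nat \<Rightarrow> int poly" where
  "top_bond_poly n = (\<Sum>xs\<in>permutations_of_set {1..n}.
     of_nat (count_adj (bond_at n) xs) * tvar ^ (count_adj bond xs - 1))"

lemma pderiv_bond_poly:
  "pderiv (bond_poly n)
    = (\<Sum>xs\<in>permutations_of_set {1..n}. of_nat (count_adj bond xs) * tvar ^ (count_adj bond xs - 1))"
  unfolding bond_poly_def using higher_pderiv_sum[of 1 "\<lambda>xs. tvar ^ count_adj bond xs"] by (simp add: pderiv_tvar_power)

lemma gap_between_bond_at:
  assumes "i \<le> length xs"
  shows "gap_between (bond_at m) xs i \<longleftrightarrow> gap_between bond xs i \<and> beside m xs i"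
  using assms by (auto simp: gap_between_def bond_at_def beside_def)

lemma count_adj_bond_at_le: "count_adj (bond_at m) xs \<le> count_adj bond xs"
  unfolding sum_gap_between[symmetric]
  by (intro sum_mono) (auto simp: gap_between_bond_at)

lemma count_adj_pos:
  assumes "gap_between P xs i"
  shows "count_adj P xs > 0"
proof -
  have "of_bool (gap_between P xs i) \<le> (\<Sum>i\<le>length xs. of_bool (gap_between P xs i) :: nat)"
    using assms by (intro member_le_sum) (auto simp: gap_between_def)
  then show ?thesis using assms by (simp add: sum_gap_between)
qed

context
  fixes n :: nat and xs :: "nat list"
  assumes n: "n \<ge> 1" and xs: "xs \<in> permutations_of_set {1..n}"
begin

private lemma len: "length xs = n"
  using length_finite_permutations_of_set[OF xs] by simp

private lemma gap_sums:
  "(\<Sum>i\<le>n. of_bool (gap_between P xs i)) = (of_nat (count_adj P xs) :: int poly)"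
  "(\<Sum>i\<le>n. of_bool (beside n xs i)) = (2 :: int poly)"
proof -
  have "(\<Sum>i\<le>n. of_bool (gap_between P xs i)) = (of_nat (\<Sum>i\<le>n. of_bool (gap_between P xs i)) :: int poly)"
    by simp
  then show "(\<Sum>i\<le>n. of_bool (gap_between P xs i)) = (of_nat (count_adj P xs) :: int poly)"
    using sum_gap_between[of P xs] by (simp only: len)
  have "(\<Sum>i\<le>n. of_bool (beside n xs i)) = (of_nat (\<Sum>i\<le>n. of_bool (beside n xs i)) :: int poly)"
    by simp
  also have "\<dots> = of_nat 2"
    using sum_beside[of xs n] n permutations_of_setD[OF xs] by (simp only: len) simp
  finally show "(\<Sum>i\<le>n. of_bool (beside n xs i)) = (2 :: int poly)" by simp
qed

text \<open>The weight of a single insertion is an affine combination of the indicators that gap \<open>i\<close> lies inside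
  a bond, is next to \<open>n\<close>, and both. Summed over the gaps, these indicators give the number of
  bonds, \<open>2\<close>, and the number of bonds containing \<open>n\<close>.\<close>

lemma sum_insert_top_bonds:
  "(\<Sum>i\<le>n. tvar ^ count_adj bond (insert_at i (Suc n) xs))
    = uvar * (of_nat (count_adj bond xs) * tvar ^ (count_adj bond xs - 1))
      + (of_nat n + 1 - 2 * uvar) * tvar ^ count_adj bond xs
      - uvar^2 * (of_nat (count_adj (bond_at n) xs) * tvar ^ (count_adj bond xs - 1))"
proof -
  define k where "k = count_adj bond xs"
  define s where "s = count_adj (bond_at n) xs"
  have "s \<le> k" by (simp add: s_def k_def count_adj_bond_at_le)
  have "(\<Sum>i\<le>n. tvar ^ count_adj bond (insert_at i (Suc n) xs))
    = (\<Sum>i\<le>n. tvar ^ k + of_bool (gap_between bond xs i) * (tvar ^ (k - 1) - tvar ^ k)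
        + of_bool (beside n xs i) * (tvar ^ (k + 1) - tvar ^ k)
        + of_bool (gap_between (bond_at n) xs i) * (2 * tvar ^ k - tvar ^ (k - 1) - tvar ^ (k + 1)))"
  proof (intro sum.cong refl)
    fix i assume "i \<in> {..n}"
    then have i: "i \<le> n" by simp
    have "gap_between bond xs i \<Longrightarrow> k > 0" using count_adj_pos k_def by blast
    then show "tvar ^ count_adj bond (insert_at i (Suc n) xs)
      = tvar ^ k + of_bool (gap_between bond xs i) * (tvar ^ (k - 1) - tvar ^ k)
        + of_bool (beside n xs i) * (tvar ^ (k + 1) - tvar ^ k)
        + of_bool (gap_between (bond_at n) xs i) * (2 * tvar ^ k - tvar ^ (k - 1) - tvar ^ (k + 1))"
      using bonds_insert_top(1)[OF xs i] gap_between_bond_at[of i xs n] i len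
      by (cases "gap_between bond xs i"; cases "beside n xs i"; cases k) (simp_all flip: k_def)
  qed
  also have "\<dots> = (of_nat n + 1) * tvar ^ k + of_nat k * (tvar ^ (k - 1) - tvar ^ k)
      + 2 * (tvar ^ (k + 1) - tvar ^ k) + of_nat s * (2 * tvar ^ k - tvar ^ (k - 1) - tvar ^ (k + 1))"
    by (simp only: sum.distrib sum_distrib_right[symmetric] gap_sums k_def s_def sum_constant) (simp add: algebra_simps)
  also have "\<dots> = uvar * (of_nat k * tvar ^ (k - 1)) + (of_nat n + 1 - 2 * uvar) * tvar ^ k
      - uvar^2 * (of_nat s * tvar ^ (k - 1))"
    using \<open>s \<le> k\<close> by (cases k) (simp_all add: uvar_def power2_eq_square algebra_simps)
  finally show ?thesis by (simp only: k_def s_def)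
qed

text \<open>Only the gaps next to \<open>n\<close> contribute. The new bond is left uncounted, so the exponent stays at the
  old number of bonds, except that it drops by one where the insertion splits a bond of \<open>n\<close>.\<close>

lemma sum_insert_top_top_bonds:
  "(\<Sum>i\<le>n. of_nat (count_adj (bond_at (Suc n)) (insert_at i (Suc n) xs))
      * tvar ^ (count_adj bond (insert_at i (Suc n) xs) - 1))
    = 2 * tvar ^ count_adj bond xs
      + uvar * (of_nat (count_adj (bond_at n) xs) * tvar ^ (count_adj bond xs - 1))"
proof -
  define k where "k = count_adj bond xs"
  define s where "s = count_adj (bond_at n) xs"
  have "s \<le> k" by (simp add: s_def k_def count_adj_bond_at_le)
  have "(\<Sum>i\<le>n. of_nat (count_adj (bond_at (Suc n)) (insert_at i (Suc n) xs))
      * tvar ^ (count_adj bond (insert_at i (Suc n) xs) - 1))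
    = (\<Sum>i\<le>n. of_bool (beside n xs i) * tvar ^ k
        + of_bool (gap_between (bond_at n) xs i) * (tvar ^ (k - 1) - tvar ^ k))"
  proof (intro sum.cong refl)
    fix i assume "i \<in> {..n}"
    then have i: "i \<le> n" by simp
    have "gap_between bond xs i \<Longrightarrow> k > 0" using count_adj_pos k_def by blast
    then show "of_nat (count_adj (bond_at (Suc n)) (insert_at i (Suc n) xs))
          * tvar ^ (count_adj bond (insert_at i (Suc n) xs) - 1)
        = of_bool (beside n xs i) * tvar ^ k
          + of_bool (gap_between (bond_at n) xs i) * (tvar ^ (k - 1) - tvar ^ k)"
      using bonds_insert_top[OF xs i] gap_between_bond_at[of i xs n] i len
      by (cases "gap_between bond xs i"; cases "beside n xs i"; cases k) (simp_all flip: k_def)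
  qed
  also have "\<dots> = 2 * tvar ^ k + of_nat s * (tvar ^ (k - 1) - tvar ^ k)"
    by (simp only: sum.distrib sum_distrib_right[symmetric] gap_sums k_def s_def)
  also have "\<dots> = 2 * tvar ^ k + uvar * (of_nat s * tvar ^ (k - 1))"
    using \<open>s \<le> k\<close> by (cases k) (simp_all add: uvar_def algebra_simps)
  finally show ?thesis by (simp only: k_def s_def)
qed

end

section \<open>Recurrences for the bond polynomials\<close>

lemma bond_poly_Suc:
  assumes "n \<ge> 1"
  shows "bond_poly (Suc n) = uvar * pderiv (bond_poly n)
    + (of_nat n + 1 - 2 * uvar) * bond_poly n - uvar^2 * top_bond_poly n"
  unfolding pderiv_bond_poly unfolding bond_poly_def top_bond_poly_def sum_permutations_Suc
  by (simp add: sum_insert_top_bonds[OF assms] sum.distrib sum_subtractf sum_distrib_left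
      del: One_nat_def)

lemma top_bond_poly_Suc:
  assumes "n \<ge> 1"
  shows "top_bond_poly (Suc n) = 2 * bond_poly n + uvar * top_bond_poly n"
  unfolding bond_poly_def top_bond_poly_def sum_permutations_Suc
  by (simp add: sum_insert_top_top_bonds[OF assms] sum.distrib sum_distrib_left del: One_nat_def)

lemma bond_poly_0: "bond_poly 0 = 1"
  and bond_poly_1: "bond_poly (Suc 0) = 1"
  and top_bond_poly_1: "top_bond_poly (Suc 0) = 0"
  by (simp_all add: bond_poly_def top_bond_poly_def)

text \<open>Elimination of \<open>top_bond_poly\<close>. For \<open>n = 0\<close> the insertion step is not available, since there is no
  entry \<open>n\<close> to be next to; the relation nevertheless holds there by direct computation.\<close>

lemma bond_poly_rec:
  "bond_poly (n + 2) = uvar * pderiv (bond_poly (n + 1)) + (of_nat n + 2 - uvar) * bond_poly (n + 1)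
    - uvar^2 * pderiv (bond_poly n) - (of_nat n + 1) * uvar * bond_poly n"
proof (cases n)
  case 0
  have "bond_poly 2 = 2 - 2 * uvar"
    using bond_poly_Suc[of 1] by (simp add: numeral_2_eq_2 bond_poly_1 top_bond_poly_1)
  then show ?thesis using 0 by (simp add: numeral_2_eq_2 bond_poly_0 bond_poly_1)
next
  case (Suc m)
  have "bond_poly (n + 2) = uvar * pderiv (bond_poly (n + 1)) + (of_nat n + 2 - 2 * uvar) * bond_poly (n + 1)
      - uvar^2 * (2 * bond_poly n + uvar * top_bond_poly n)"
    using bond_poly_Suc[of "n + 1"] top_bond_poly_Suc[of n] Suc by (simp add: algebra_simps)
  moreover have "uvar^2 * top_bond_poly n
      = uvar * pderiv (bond_poly n) + (of_nat n + 1 - 2 * uvar) * bond_poly n - bond_poly (n + 1)"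
    using bond_poly_Suc[of n] Suc by simp
  ultimately show ?thesis by algebra
qed

lemma pderiv_numeral: "pderiv (numeral k :: int poly) = 0"
  by (metis of_nat_numeral pderiv_of_nat)

lemmas pderiv_rules = pderiv_mult pderiv_add pderiv_diff pderiv_uvar pderiv_numeral

text \<open>Let \<open>R n\<close> be the difference of the two sides. On generating functions, \<open>bond_poly_rec\<close> says
  that \<open>L = (1 + z) - x (1 - z) (1 + W)\<close> sends the series of the \<open>bond_poly n\<close> to \<open>1 + z\<close>, where
  \<open>W = x \<partial>\<^sub>x - u \<partial>\<^sub>u\<close> and \<open>z = u x\<close>. Up to the factor \<open>-u\<close>, the series of the \<open>R n\<close> is the image
  under \<open>N = (1 - 2z - z\<^sup>2) u \<partial>\<^sub>u + 2z x \<partial>\<^sub>x\<close>. Since \<open>W\<close> commutes with \<open>N\<close>, moving \<open>N\<close> past \<open>L\<close>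
  gives \<open>N L = L N + z (1 - z) L\<close>, whence \<open>L\<close> maps the image under \<open>N\<close> to
  \<open>(N - z (1 - z)) (1 + z) = 0\<close>. In coefficients, \<open>R\<close> obeys a homogeneous recurrence of order two,
  and it vanishes because its first two terms do.\<close>

lemma pderiv_bond_poly_rec:
  "pderiv (bond_poly (n + 2)) = 2 * uvar * pderiv (bond_poly (n + 1)) + uvar^2 * pderiv (bond_poly n)
    + 2 * (of_nat n + 1) * bond_poly (n + 1)"
proof -
  define R where "R n = pderiv (bond_poly (n+2)) - (2 * uvar * pderiv (bond_poly (n+1)) + uvar^2 * pderiv (bond_poly n) + 2 * (of_nat n + 1) * bond_poly (n+1))" for n
  have dE: "pderiv (bond_poly (n+2)) = uvar * pderiv (pderiv (bond_poly (n+1))) + (of_nat n + 1 - uvar) * pderiv (bond_poly (n+1)) + bond_poly (n+1)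
     - uvar^2 * pderiv (pderiv (bond_poly n)) - (of_nat n - 1) * uvar * pderiv (bond_poly n) + (of_nat n + 1) * bond_poly n" for n
    unfolding bond_poly_rec[of n]
    by (simp add: pderiv_rules power2_eq_square)
       algebra
  have dR: "pderiv (R n) = pderiv (pderiv (bond_poly (n+2))) - 2 * uvar * pderiv (pderiv (bond_poly (n+1))) - uvar^2 * pderiv (pderiv (bond_poly n))
     - 2 * of_nat n * pderiv (bond_poly (n+1)) + 2 * uvar * pderiv (bond_poly n)" for n
    unfolding R_def
    by (simp add: pderiv_rules power2_eq_square)
       algebra
  have step: "R (n+2) = uvar * pderiv (R (n+1)) + (of_nat n + 3 - uvar) * R (n+1) - uvar^2 * pderiv (R n) - (of_nat n + 2) * uvar * R n" for n
  proof -
    define N :: "int poly" where "N = of_nat n"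
    have idx: "n + 1 + 1 = n + 2" "n + 1 + 2 = n + 3" "n + 2 + 1 = n + 3" "n + 2 + 2 = n + 4" by simp_all
    have N: "of_nat (n + 1) = N + 1" "of_nat (n + 2) = N + 2" "of_nat n = N" by (simp_all add: N_def)
    note rec = bond_poly_rec[of n] bond_poly_rec[of "n+1"] dE[of n] dE[of "n+1"] dE[of "n+2"]
    \<comment> \<open>The certificate, with \<open>E\<close> the difference of the two sides of \<open>bond_poly_rec\<close>: the claim is
      \<open>E'\<^sub>n\<^sub>+\<^sub>2 - 2 u E'\<^sub>n\<^sub>+\<^sub>1 - u\<^sup>2 E'\<^sub>n - (2 n + 5) E\<^sub>n\<^sub>+\<^sub>1 - u E\<^sub>n = 0\<close>.\<close>
    show ?thesis
      using rec[unfolded idx N]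
      unfolding dR unfolding R_def idx N by algebra
  qed
  have "R n = 0 \<and> R (Suc n) = 0"
  proof (induction n)
    case 0
    have T2: "bond_poly (Suc (Suc 0)) = 2 - 2 * uvar"
      using bond_poly_rec[of 0] by (simp add: bond_poly_0 bond_poly_1 algebra_simps)
    have T3: "bond_poly (Suc (Suc (Suc 0))) = 6 - 8 * uvar + 2 * uvar^2"
      using bond_poly_rec[of 1] by (simp add: bond_poly_1 T2 pderiv_rules algebra_simps power2_eq_square)
    have "R 0 = 0"
      by (simp add: R_def bond_poly_0 bond_poly_1 T2 pderiv_rules)
    moreover have "R (Suc 0) = 0"
      by (simp add: R_def bond_poly_1 T2 T3 pderiv_rules power2_eq_square algebra_simps)
    ultimately show ?case by simp
  next
    case (Suc n)
    then show ?case using step[of n] by simp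
  qed
  then show ?thesis by (simp add: R_def)
qed

section \<open>From permutations to lists\<close>

lemma bij_betw_permutes_permutations_of_set:
  "bij_betw (\<lambda>p. map p [1..<Suc n]) {p. p permutes {1..n}} (permutations_of_set {1..n})"
  unfolding bij_betw_def
proof
  show inj: "inj_on (\<lambda>p. map p [1..<Suc n]) {p. p permutes {1..n}}"
  proof (rule inj_onI, clarify)
    fix p q assume p: "p permutes {1..n}" and q: "q permutes {1..n}"
      and eq: "map p [1..<Suc n] = map q [1..<Suc n]"
    show "p = q"
    proof
      fix i show "p i = q i"
        using eq permutes_not_in[OF p, of i] permutes_not_in[OF q, of i]
        by (cases "i \<in> {1..n}") (auto simp del: upt_Suc)
    qed
  qed
  show "(\<lambda>p. map p [1..<Suc n]) ` {p. p permutes {1..n}} = permutations_of_set {1..n}"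
  proof (rule card_subset_eq)
    show "(\<lambda>p. map p [1..<Suc n]) ` {p. p permutes {1..n}} \<subseteq> permutations_of_set {1..n}"
    proof clarify
      fix p assume p: "p permutes {1..n}"
      have "set (map p [1..<Suc n]) = {1..n}"
        using permutes_image[OF p] by (simp add: atLeastLessThanSuc_atLeastAtMost del: upt_Suc)
      moreover have "distinct (map p [1..<Suc n])"
        using permutes_inj_on[OF p] by (simp add: distinct_map del: upt_Suc)
      ultimately show "map p [1..<Suc n] \<in> permutations_of_set {1..n}" by blast
    qed
    show "card ((\<lambda>p. map p [1..<Suc n]) ` {p. p permutes {1..n}}) = card (permutations_of_set {1..n})"
      unfolding card_image[OF inj] using card_permutations[of "{1..n}" n] by simp
  qed simp
qed

lemma count_adj_eq_0_iff: "count_adj P xs = 0 \<longleftrightarrow> (\<forall>i. \<not> gap_between P xs i)"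
proof
  show "count_adj P xs = 0 \<Longrightarrow> \<forall>i. \<not> gap_between P xs i"
    using count_adj_pos[of P xs] by fastforce
  show "\<forall>i. \<not> gap_between P xs i \<Longrightarrow> count_adj P xs = 0"
    unfolding sum_gap_between[symmetric] by simp
qed

lemma nonconsecutive_iff_no_bonds:
  "(\<forall>i\<in>{1..<n}. \<bar>int (p (i + 1)) - int (p i)\<bar> \<noteq> 1) \<longleftrightarrow> count_adj bond (map p [1..<Suc n]) = 0"
proof -
  have "gap_between bond (map p [1..<Suc n]) i \<longleftrightarrow> i \<in> {1..<n} \<and> \<bar>int (p (i + 1)) - int (p i)\<bar> = 1" for i
    by (auto simp: gap_between_def bond_def simp del: upt_Suc)
  then show ?thesis by (auto simp: count_adj_eq_0_iff)
qed

text \<open>At \<open>t = 0\<close> only the permutations without bonds survive, as \<open>0 ^ 0 = 1\<close>.\<close>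

lemma num_nonconsecutive_perms_eq_poly: "int (num_nonconsecutive_perms n) = poly (bond_poly n) 0"
proof -
  let ?P = "permutations_of_set {1..n}"
  have "bij_betw (\<lambda>p. map p [1..<Suc n]) (nonconsecutive_perms n) {xs \<in> ?P. count_adj bond xs = 0}"
    using bij_betw_permutes_permutations_of_set[of n]
    unfolding nonconsecutive_perms_def nonconsecutive_iff_no_bonds bij_betw_def
    by (auto simp: inj_on_def simp del: upt_Suc)
  then have "num_nonconsecutive_perms n = card {xs \<in> ?P. count_adj bond xs = 0}"
    unfolding num_nonconsecutive_perms_def by (rule bij_betw_same_card)
  also have "int \<dots> = (\<Sum>xs\<in>?P. 0 ^ count_adj bond xs)"
    unfolding card_eq_sum of_nat_sum sum.inter_filter[OF finite_permutations_of_set]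
    by (intro sum.cong) (auto simp: power_0_left)
  also have "\<dots> = poly (bond_poly n) 0"
    by (simp add: bond_poly_def poly_sum tvar_def)
  finally show ?thesis .
qed

theorem proposition2:
  fixes n :: nat
  assumes "n \<ge> 4"
  shows "int (num_nonconsecutive_perms n) =
           (int n + 1) * int (num_nonconsecutive_perms (n - 1))
         - (int n - 2) * int (num_nonconsecutive_perms (n - 2))
         - (int n - 5) * int (num_nonconsecutive_perms (n - 3))
         + (int n - 3) * int (num_nonconsecutive_perms (n - 4))"
proof -
  define a where "a k = int (num_nonconsecutive_perms k)" for k
  define b where "b k = poly (pderiv (bond_poly k)) 0" for k
  have eval: "poly (bond_poly k) 0 = a k" "poly uvar 0 = 1" for k
    by (simp_all add: a_def num_nonconsecutive_perms_eq_poly uvar_def tvar_def)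
  have rec_a: "a (k + 2) = b (k + 1) - b k + (int k + 1) * a (k + 1) - (int k + 1) * a k" for k
    using arg_cong[OF bond_poly_rec[of k], of "\<lambda>q. poly q 0"] by (simp add: eval b_def)
  have rec_b: "b (k + 2) = 2 * b (k + 1) + b k + 2 * (int k + 1) * a (k + 1)" for k
    using arg_cong[OF pderiv_bond_poly_rec[of k], of "\<lambda>q. poly q 0"] by (simp add: eval b_def)
  obtain k where n: "n = k + 4"
    using assms by (metis add.commute le_Suc_ex)
  \<comment> \<open>By \<open>rec_a\<close>, \<open>b (k + 1) - b k\<close> is a combination of values of \<open>a\<close>. The difference of two
    consecutive instances of \<open>rec_b\<close> contains only such differences, so \<open>b\<close> drops out.\<close>
  have "a (k + 4) = (int k + 5) * a (k + 3) - (int k + 2) * a (k + 2) - (int k - 1) * a (k + 1) + (int k + 1) * a k"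
    using rec_a[of k] rec_a[of "k + 1"] rec_a[of "k + 2"] rec_b[of k] rec_b[of "k + 1"]
    by (simp add: numeral_eq_Suc algebra_simps)
  then show ?thesis by (simp add: a_def n numeral_eq_Suc algebra_simps)
qed

end
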